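(* The sextic equation $$\begin{aligned} &(44x_3^2-36x_3x_4+36x_4^2)x_1^4+(300x_2^2x_3^2+12x_2^2x_3x_4\\ &+36x_2^2x_4^2+120x_2x_3^3+48x_2x_3^2x_4+288x_2x_3x_4^2-216x_2x_4^3)x_1^2\\ &+540x_2^4x_3^2+540x_2^4x_3x_4+324x_2^4x_4^2+432x_2^3x_3^3\\ &+648x_2^3x_3^2x_4+1512x_2^3x_3x_4^2+648x_2^3x_4^3-9x_2^2x_3^4\\ &-18x_2^2x_3^3x_4-63x_2^2x_3^2x_4^2-54x_2^2x_3x_4^3-81x_2^2x_4^4\\ &-972x_2x_3^5-2430x_2x_3^4x_4-7776x_2x_3^3x_4^2-9234x_2x_3^2x_4^3\\ &-11664x_2x_3x_4^4-4374x_2x_4^5+9x_3^6+27x_3^5x_4+90x_3^4x_4^2\\ &+135x_3^3x_4^3+198x_3^2x_4^4+135x_3x_4^5+81x_4^6=0 \end{aligned}$$ has infinitely many integer solutions $(x_1,x_2,x_3,x_4)$ with $(x_1,x_2)\neq(0,0)$ and $(x_3,x_4)\neq(0,0)$, no two of which are proportional. *)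

theory Defs
  imports Complex_Main
begin

definition sextic :: "int \<Rightarrow> int \<Rightarrow> int \<Rightarrow> int \<Rightarrow> int" where
  "sextic x1 x2 x3 x4 =
     (44*x3^2 - 36*x3*x4 + 36*x4^2) * x1^4
   + (300*x2^2*x3^2 + 12*x2^2*x3*x4
      + 36*x2^2*x4^2 + 120*x2*x3^3 + 48*x2*x3^2*x4 + 288*x2*x3*x4^2 - 216*x2*x4^3) * x1^2
   + 540*x2^4*x3^2 + 540*x2^4*x3*x4 + 324*x2^4*x4^2 + 432*x2^3*x3^3
   + 648*x2^3*x3^2*x4 + 1512*x2^3*x3*x4^2 + 648*x2^3*x4^3 - 9*x2^2*x3^4
   - 18*x2^2*x3^3*x4 - 63*x2^2*x3^2*x4^2 - 54*x2^2*x3*x4^3 - 81*x2^2*x4^4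
   - 972*x2*x3^5 - 2430*x2*x3^4*x4 - 7776*x2*x3^3*x4^2 - 9234*x2*x3^2*x4^3
   - 11664*x2*x3*x4^4 - 4374*x2*x4^5 + 9*x3^6 + 27*x3^5*x4 + 90*x3^4*x4^2
   + 135*x3^3*x4^3 + 198*x3^2*x4^4 + 135*x3*x4^5 + 81*x4^6"

text \<open>Proportionality is over the rationals, so that for instance \<open>(2,2,2,2)\<close> and
  \<open>(3,3,3,3)\<close> are proportional; on nonzero vectors the relation is symmetric.\<close>

definition proportional :: "int \<times> int \<times> int \<times> int \<Rightarrow> int \<times> int \<times> int \<times> int \<Rightarrow> bool" where
  "proportional = (\<lambda>(x1, x2, x3, x4) (y1, y2, y3, y4).
     \<exists>c :: rat. of_int y1 = c * of_int x1 \<and> of_int y2 = c * of_int x2 \<and>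
                of_int y3 = c * of_int x3 \<and> of_int y4 = c * of_int x4)"

end

theory Submission
  imports Defs
begin

text \<open>
  Infinitely many solutions are produced by iterating one polynomial self-map of the surface on a
  single solution.

  Let \<open>\<theta> = (1 + \<surd>(-11)) / 2\<close>, and collect the four coordinates into two elements of
  \<open>\<int>[\<theta>]\<close>, namely \<open>\<xi> = x1 + \<theta>' x2\<close> (where \<open>\<theta>' = 1 - \<theta>\<close> is the conjugate of \<open>\<theta>\<close>) and
  \<open>\<alpha> = x3 + \<theta> x4\<close>. In terms of \<open>\<xi>\<close>, \<open>\<alpha>\<close> and their conjugates, the sextic has only terms of bidegree
  \<open>(4,2)\<close>, \<open>(3,3)\<close> and \<open>(2,4)\<close>; that is, it is \<open>A + B + A'\<close> with \<open>A\<close> of bidegree \<open>(4,2)\<close>, \<open>A'\<close> its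
  conjugate and \<open>B\<close> of bidegree \<open>(3,3)\<close> (lemma \<open>sextic_decomposition\<close>). Multiplying \<open>\<xi>\<close> and \<open>\<alpha>\<close> by
  one number \<open>r\<close> with conjugate \<open>r'\<close> turns this sum into \<open>(r r')\<^sup>2 (r\<^sup>2 A + r r' B + r'\<^sup>2 A')\<close>. For
  \<open>r = A'\<close> the second factor is \<open>A A' (A + B + A')\<close>, so solutions go to solutions. Geometrically this
  exchanges the two points of the surface with the same ratio \<open>\<xi> : \<alpha>\<close>. Composed with the symmetry
  \<open>x1 \<mapsto> - x1\<close> it gives the map \<open>step\<close>, homogeneous of degree 7 (lemma \<open>sextic_step\<close>).

  It remains to see that the orbit of \<open>(33, -1, 3, -33)\<close> is infinite as a set of projective points.
  Suppose it were eventually periodic with minimal period \<open>n\<close>. Modulo 7 the orbit has period 33, so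
  \<open>11\<close> divides \<open>n\<close> (lemma \<open>orbit_separated_mod_11\<close>). Modulo 2 the coordinate \<open>x2\<close> is always odd, so
  all orbit points lie in the affine chart \<open>x2 \<noteq> 0\<close> over the 2-adic integers, \<open>step\<close> acts on the orbit
  modulo every power of 2, and a class modulo \<open>2^k\<close> splits into at most \<open>2^3 = 8\<close> classes modulo
  \<open>2^(k+1)\<close> (lemma \<open>orbit_proj_cong_split\<close>). But the iterate \<open>step^(n/11)\<close> permutes 11 points of the
  orbit cyclically. At the first power of 2 at which these 11 points are not all congruent, they are
  pairwise incongruent, because 11 is prime, and 11 classes do not fit into 8
  (lemma \<open>refinement_separates\<close>).
\<close>

section \<open>The quadratic order of discriminant -11\<close>

text \<open>
  \<open>Q a b\<close> stands for \<open>a + b \<theta>\<close> with \<open>\<theta>\<^sup>2 = \<theta> - 3\<close>. A datatype with integer components, rather than a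
  subring of the complex numbers, lets the orbit be computed and reduced modulo integers.
\<close>

datatype quadint = Q (rat_part: int) (theta_part: int)

instantiation quadint :: comm_ring_1
begin

definition zero_quadint where "0 = Q 0 0"
definition one_quadint where "1 = Q 1 0"
fun plus_quadint where "Q a b + Q c d = Q (a + c) (b + d)"
fun minus_quadint where "Q a b - Q c d = Q (a - c) (b - d)"
fun uminus_quadint where "- Q a b = Q (- a) (- b)"
fun times_quadint where "Q a b * Q c d = Q (a * c - 3 * b * d) (a * d + b * c + b * d)"

instance
proof
  fix x y z :: quadint
  show "x + y + z = x + (y + z)" by (cases x; cases y; cases z) simp
  show "x + y = y + x" by (cases x; cases y) simp
  show "0 + x = x" by (cases x) (simp add: zero_quadint_def)
  show "- x + x = 0" by (cases x) (simp add: zero_quadint_def)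
  show "x - y = x + - y" by (cases x; cases y) simp
  show "x * y * z = x * (y * z)" by (cases x; cases y; cases z) (simp add: algebra_simps)
  show "x * y = y * x" by (cases x; cases y) (simp add: algebra_simps)
  show "1 * x = x" by (cases x) (simp add: one_quadint_def)
  show "(x + y) * z = x * z + y * z"
    by (cases x; cases y; cases z) (simp add: algebra_simps)
  show "(0 :: quadint) \<noteq> 1" by (simp add: zero_quadint_def one_quadint_def)
qed

end

lemma of_int_quadint: "of_int n = Q n 0"
proof (induction n rule: int_of_nat_induct)
  have nat: "of_nat m = Q (int m) 0" for m
    by (induction m) (simp_all add: zero_quadint_def one_quadint_def)
  fix m
  show "of_int (int m) = Q (int m) 0" by (simp add: nat)
  show "of_int (- int (Suc m)) = Q (- int (Suc m)) 0"
    by (simp only: of_int_minus of_int_of_nat_eq nat) simp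
qed

fun qcnj :: "quadint \<Rightarrow> quadint" where
  "qcnj (Q a b) = Q (a + b) (- b)"

lemma qcnj_mult: "qcnj (x * y) = qcnj x * qcnj y"
  by (cases x; cases y) (simp add: algebra_simps)

lemma qcnj_add: "qcnj (x + y) = qcnj x + qcnj y"
  by (cases x; cases y) simp

lemma qcnj_diff: "qcnj (x - y) = qcnj x - qcnj y"
  by (cases x; cases y) simp

lemma qcnj_qcnj [simp]: "qcnj (qcnj x) = x"
  by (cases x) simp

lemma qcnj_of_int [simp]: "qcnj (of_int n) = of_int n"
  by (simp add: of_int_quadint)

lemma qcnj_power: "qcnj (x ^ n) = qcnj x ^ n"
  using qcnj_of_int[of 1] by (induction n) (simp_all add: qcnj_mult)

lemma of_int_dvd_Q: "of_int M dvd Q a b \<longleftrightarrow> M dvd a \<and> M dvd b"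
proof
  assume "of_int M dvd Q a b"
  then obtain z where "Q a b = of_int M * z" by (auto simp: dvd_def)
  then show "M dvd a \<and> M dvd b" by (cases z) (simp add: of_int_quadint)
next
  assume "M dvd a \<and> M dvd b"
  then obtain c d where "a = M * c" "b = M * d" by (auto simp: dvd_def)
  then have "Q a b = of_int M * Q c d" by (simp add: of_int_quadint)
  then show "of_int M dvd Q a b" by simp
qed

section \<open>The bihomogeneous decomposition of the sextic\<close>

text \<open>
  The arguments \<open>\<eta>\<close> and \<open>\<beta>\<close> stand for the conjugates of \<open>\<xi>\<close> and \<open>\<alpha>\<close>; keeping them independent makes
  the bidegrees visible to the laws \<open>lead_mult\<close> and \<open>mid_mult\<close>. The coefficients of this form and
  the next come from substituting \<open>x1 = (\<theta> \<xi> - \<theta>' \<eta>) / \<delta>\<close>, \<open>x2 = (\<eta> - \<xi>) / \<delta>\<close>,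
  \<open>x3 = (\<theta> \<beta> - \<theta>' \<alpha>) / \<delta>\<close> and \<open>x4 = (\<alpha> - \<beta>) / \<delta>\<close>, where \<open>\<delta> = \<theta> - \<theta>'\<close> and \<open>\<delta>\<^sup>2 = -11\<close>, into the sextic and
  multiplying by \<open>121\<close>, which clears all denominators.
\<close>

definition lead :: "quadint \<Rightarrow> quadint \<Rightarrow> quadint \<Rightarrow> quadint \<Rightarrow> quadint" where
  "lead \<xi> \<alpha> \<eta> \<beta> =
     Q 198 0 * \<alpha>^4 * \<beta>^2 + Q 5346 (-10692) * \<xi> * \<alpha>^3 * \<beta>^2 + Q 99 0 * \<xi>^2 * \<alpha>^2 * \<beta>^2
   + Q (-1584) 1584 * \<xi>^2 * \<alpha>^2 * \<eta> * \<beta> + Q 1152 576 * \<xi>^2 * \<alpha>^2 * \<eta>^2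
   + Q 792 (-264) * \<xi>^3 * \<alpha> * \<beta>^2 + Q 0 (-744) * \<xi>^3 * \<alpha> * \<eta> * \<beta> + Q (-96) 80 * \<xi>^4 * \<beta>^2"

definition mid :: "quadint \<Rightarrow> quadint \<Rightarrow> quadint \<Rightarrow> quadint \<Rightarrow> quadint" where
  "mid \<xi> \<alpha> \<eta> \<beta> =
     Q 693 0 * \<alpha>^3 * \<beta>^3 + Q (-5346) 10692 * \<alpha>^3 * \<eta> * \<beta>^2 + Q 5346 (-10692) * \<xi> * \<alpha>^2 * \<beta>^3
   + Q (-198) 0 * \<xi> * \<alpha>^2 * \<eta> * \<beta>^2 + Q 1056 (-1848) * \<xi> * \<alpha>^2 * \<eta>^2 * \<beta>
   + Q (-960) 384 * \<xi> * \<alpha>^2 * \<eta>^3 + Q (-792) 1848 * \<xi>^2 * \<alpha> * \<eta> * \<beta>^2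
   + Q 4836 0 * \<xi>^2 * \<alpha> * \<eta>^2 * \<beta> + Q (-576) (-384) * \<xi>^3 * \<eta> * \<beta>^2"

lemma lead_mult: "lead (r * \<xi>) (r * \<alpha>) (s * \<eta>) (s * \<beta>) = r^4 * s^2 * lead \<xi> \<alpha> \<eta> \<beta>"
  by (simp add: lead_def power_mult_distrib ring_distribs power4_eq_xxxx power3_eq_cube power2_eq_square mult_ac)

lemma mid_mult: "mid (r * \<xi>) (r * \<alpha>) (s * \<eta>) (s * \<beta>) = r^3 * s^3 * mid \<xi> \<alpha> \<eta> \<beta>"
  by (simp add: mid_def power_mult_distrib ring_distribs power3_eq_cube power2_eq_square mult_ac)

type_synonym point = "quadint \<times> quadint"

definition pt :: "int \<Rightarrow> int \<Rightarrow> int \<Rightarrow> int \<Rightarrow> point" where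
  "pt x1 x2 x3 x4 = (Q (x1 + x2) (- x2), Q x3 x4)"

text \<open>
  Of the seven bidegrees \<open>(i, 6 - i)\<close> possible in a sextic only three occur. Hence for
  the points \<open>(r \<xi>, r \<alpha>)\<close>, with \<open>(\<xi>, \<alpha>)\<close> fixed, the equation is quadratic in \<open>r / r'\<close>. If \<open>(\<xi>, \<alpha>)\<close> is a
  solution, then one root is \<open>1\<close>, and the other one is \<open>A' / A\<close>, which is attained at \<open>r = A'\<close>.
\<close>

lemma sextic_decomposition:
  assumes "pt x1 x2 x3 x4 = (\<xi>, \<alpha>)"
  shows "of_int (121 * sextic x1 x2 x3 x4) =
    lead \<xi> \<alpha> (qcnj \<xi>) (qcnj \<alpha>) + mid \<xi> \<alpha> (qcnj \<xi>) (qcnj \<alpha>) + qcnj (lead \<xi> \<alpha> (qcnj \<xi>) (qcnj \<alpha>))"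
proof -
  have \<xi>: "\<xi> = Q (x1 + x2) (- x2)" and \<alpha>: "\<alpha> = Q x3 x4"
    using assms by (simp_all add: pt_def)
  show ?thesis
    unfolding \<xi> \<alpha> of_int_quadint lead_def mid_def sextic_def qcnj_add qcnj_mult qcnj_power qcnj_qcnj
    by (simp add: power4_eq_xxxx power3_eq_cube power2_eq_square) (intro conjI; algebra)
qed

section \<open>The self-map of the surface\<close>

text \<open>The symmetry \<open>x1 \<mapsto> - x1\<close> in the coordinate \<open>\<xi>\<close>, with \<open>x1 = a + b\<close> and \<open>x2 = - b\<close> for \<open>\<xi> = Q a b\<close>.\<close>

definition reflect :: "quadint \<Rightarrow> quadint" where
  "reflect \<xi> = Q (- rat_part \<xi> - 2 * theta_part \<xi>) (theta_part \<xi>)"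

definition multiplier :: "point \<Rightarrow> quadint" where
  "multiplier s = (case s of (\<xi>, \<alpha>) \<Rightarrow> qcnj (lead (reflect \<xi>) \<alpha> (qcnj (reflect \<xi>)) (qcnj \<alpha>)))"

definition step :: "point \<Rightarrow> point" where
  "step s = (multiplier s * reflect (fst s), multiplier s * snd s)"

lemma pt_cases: obtains x1 x2 x3 x4 where "s = pt x1 x2 x3 x4"
proof (cases s)
  case (Pair \<xi> \<alpha>)
  then have "s = pt (rat_part \<xi> + theta_part \<xi>) (- theta_part \<xi>) (rat_part \<alpha>) (theta_part \<alpha>)"
    by (simp add: pt_def)
  then show ?thesis by (rule that)
qed

lemma reflect_pt: "(reflect (fst (pt x1 x2 x3 x4)), snd (pt x1 x2 x3 x4)) = pt (- x1) x2 x3 x4"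
  by (simp add: reflect_def pt_def)

text \<open>
  With \<open>r = A'\<close> the transformed terms \<open>r^4 r'^2 A\<close>, \<open>r^3 r'^3 B\<close>, \<open>r^2 r'^4 A'\<close> are \<open>(A A')^3\<close> times \<open>A'\<close>,
  \<open>B\<close>, \<open>A\<close>: the outer two terms are exchanged, and the sum stays zero.
\<close>

lemma sextic_step:
  assumes "sextic x1 x2 x3 x4 = 0" and "step (pt x1 x2 x3 x4) = pt y1 y2 y3 y4"
  shows "sextic y1 y2 y3 y4 = 0"
proof -
  obtain \<xi> \<alpha> where \<xi>\<alpha>: "pt (- x1) x2 x3 x4 = (\<xi>, \<alpha>)" by (metis surj_pair)
  define A where "A = lead \<xi> \<alpha> (qcnj \<xi>) (qcnj \<alpha>)"
  define B where "B = mid \<xi> \<alpha> (qcnj \<xi>) (qcnj \<alpha>)"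
  have "sextic (- x1) x2 x3 x4 = 0"
    using assms(1) by (simp add: sextic_def)
  then have sum0: "A + B + qcnj A = 0"
    using sextic_decomposition[OF \<xi>\<alpha>] by (simp add: A_def B_def)
  have mult: "multiplier (pt x1 x2 x3 x4) = qcnj A"
    using reflect_pt[of x1 x2 x3 x4] \<xi>\<alpha> by (simp add: multiplier_def A_def split_beta)
  have y: "pt y1 y2 y3 y4 = (qcnj A * \<xi>, qcnj A * \<alpha>)"
    using assms(2) reflect_pt[of x1 x2 x3 x4] \<xi>\<alpha> by (simp add: step_def mult)
  have "lead (qcnj A * \<xi>) (qcnj A * \<alpha>) (qcnj (qcnj A * \<xi>)) (qcnj (qcnj A * \<alpha>)) = qcnj A ^ 4 * A ^ 2 * A"
    "mid (qcnj A * \<xi>) (qcnj A * \<alpha>) (qcnj (qcnj A * \<xi>)) (qcnj (qcnj A * \<alpha>)) = qcnj A ^ 3 * A ^ 3 * B"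
    by (simp_all only: qcnj_mult qcnj_qcnj lead_mult mid_mult A_def[symmetric] B_def[symmetric])
  then have "of_int (121 * sextic y1 y2 y3 y4) =
      qcnj A ^ 4 * A ^ 2 * A + qcnj A ^ 3 * A ^ 3 * B + A ^ 4 * qcnj A ^ 2 * qcnj A"
    using sextic_decomposition[OF y] by (simp add: qcnj_mult qcnj_power)
  also have "\<dots> = (qcnj A * A) ^ 3 * (A + B + qcnj A)"
    by (simp add: algebra_simps power4_eq_xxxx power3_eq_cube power2_eq_square)
  also have "\<dots> = 0" by (simp only: sum0 mult_zero_right)
  finally show ?thesis by (simp add: of_int_quadint zero_quadint_def)
qed

section \<open>Congruence of vectors and of projective points\<close>

definition scale :: "int \<Rightarrow> point \<Rightarrow> point" where
  "scale c s = (of_int c * fst s, of_int c * snd s)"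

definition scong :: "int \<Rightarrow> point \<Rightarrow> point \<Rightarrow> bool" where
  "scong M s t \<longleftrightarrow> of_int M dvd fst s - fst t \<and> of_int M dvd snd s - snd t"

lemma scong_iff:
  "scong M s t \<longleftrightarrow>
     M dvd rat_part (fst s) - rat_part (fst t) \<and> M dvd theta_part (fst s) - theta_part (fst t) \<and>
     M dvd rat_part (snd s) - rat_part (snd t) \<and> M dvd theta_part (snd s) - theta_part (snd t)"
  by (cases "fst s"; cases "fst t"; cases "snd s"; cases "snd t") (auto simp: scong_def of_int_dvd_Q)

lemma scong_refl [simp]: "scong M s s"
  by (simp add: scong_def)

lemma scong_sym: "scong M s t \<Longrightarrow> scong M t s"
  by (auto simp: scong_iff dvd_diff_commute)

lemma scong_trans [trans]: "scong M s t \<Longrightarrow> scong M t u \<Longrightarrow> scong M s u"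
  unfolding scong_def by (metis diff_add_cancel add_diff_eq dvd_add)

lemma scong_scale: "scong M s t \<Longrightarrow> scong M (scale c s) (scale c t)"
  by (simp add: scong_def scale_def flip: right_diff_distrib)

lemma scong_scale_cong: "M dvd c - d \<Longrightarrow> scong M (scale c s) (scale d s)"
  unfolding scong_def scale_def
  by (metis (no_types, lifting) dvd_mult2 fst_conv snd_conv left_diff_distrib of_int_diff of_int_dvd_Q of_int_quadint dvd_0_right)

lemma scale_scale [simp]: "scale c (scale d s) = scale (c * d) s"
  by (simp add: scale_def mult.assoc)

lemma scong_cancel:
  assumes "scong M (scale c s) (scale c t)" "coprime c M"
  shows "scong M s t"
proof -
  have "M dvd c * z \<longleftrightarrow> M dvd z" for z
    using assms(2) by (simp add: coprime_commute coprime_dvd_mult_right_iff)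
  moreover have "rat_part (of_int c * z) = c * rat_part z" "theta_part (of_int c * z) = c * theta_part z" for z
    by (cases z; simp add: of_int_quadint)+
  ultimately show ?thesis
    using assms(1) by (simp add: scong_iff scale_def flip: right_diff_distrib)
qed

text \<open>
  The next lemmas say that polynomial expressions preserve congruence, stated through divisibility
  of differences, which makes sense in every commutative ring.
\<close>

lemma dvd_mult_diff:
  fixes m :: "'a::comm_ring_1"
  assumes "m dvd a - b" "m dvd c - d"
  shows "m dvd a * c - b * d"
proof -
  have "a * c - b * d = a * (c - d) + (a - b) * d" by (simp add: algebra_simps)
  then show ?thesis using assms by simp
qed

lemma dvd_add_diff:
  fixes m :: "'a::comm_ring_1"
  assumes "m dvd a - b" "m dvd c - d"
  shows "m dvd (a + c) - (b + d)"
  using dvd_add[OF assms] by (simp add: algebra_simps)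

lemma dvd_power_diff:
  fixes m :: "'a::comm_ring_1"
  assumes "m dvd a - b"
  shows "m dvd a ^ n - b ^ n"
  by (induction n) (simp_all add: dvd_mult_diff assms)

lemma dvd_qcnj_diff: "of_int M dvd x - y \<Longrightarrow> of_int M dvd qcnj x - qcnj y"
  by (metis dvd_def qcnj_diff qcnj_mult qcnj_of_int)

lemma dvd_reflect_diff: "of_int M dvd x - y \<Longrightarrow> of_int M dvd reflect x - reflect y"
proof (cases x; cases y)
  fix a b c d
  assume "of_int M dvd x - y" and xy: "x = Q a b" "y = Q c d"
  then have dvd: "M dvd a - c" "M dvd b - d" by (simp_all add: of_int_dvd_Q)
  have "(- a - 2 * b) - (- c - 2 * d) = - (a - c) - 2 * (b - d)" by simp
  then have "M dvd (- a - 2 * b) - (- c - 2 * d)"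
    using dvd by (metis dvd_diff dvd_minus_iff dvd_mult)
  then show "of_int M dvd reflect x - reflect y"
    using dvd by (simp add: reflect_def of_int_dvd_Q xy)
qed

lemma lead_diff:
  assumes "m dvd \<xi> - \<xi>'" "m dvd \<alpha> - \<alpha>'" "m dvd \<eta> - \<eta>'" "m dvd \<beta> - \<beta>'"
  shows "m dvd lead \<xi> \<alpha> \<eta> \<beta> - lead \<xi>' \<alpha>' \<eta>' \<beta>'"
  unfolding lead_def by (intro dvd_add_diff dvd_mult_diff dvd_power_diff assms) simp_all

lemma scong_step:
  assumes "scong M s t"
  shows "scong M (step s) (step t)"
proof -
  have "of_int M dvd multiplier s - multiplier t"
    using assms by (auto simp: multiplier_def scong_def split_beta
        intro!: dvd_qcnj_diff lead_diff dvd_reflect_diff)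
  then show ?thesis
    using assms by (auto simp: step_def scong_def intro!: dvd_mult_diff dvd_reflect_diff)
qed

lemma reflect_of_int_mult: "reflect (of_int c * z) = of_int c * reflect z"
  by (cases z) (simp add: reflect_def of_int_quadint algebra_simps)

lemma step_scale: "step (scale c s) = scale (c ^ 7) (step s)"
proof -
  have "multiplier (scale c s) = of_int c ^ 6 * multiplier s"
    by (simp add: multiplier_def scale_def split_beta reflect_of_int_mult qcnj_mult lead_mult qcnj_power
        flip: power_add)
  then show ?thesis
    by (simp add: step_def scale_def reflect_of_int_mult mult_ac eval_nat_numeral)
qed

text \<open>
  This is \<open>- x2\<close>. It serves as the common denominator in the affine chart \<open>x2 \<noteq> 0\<close>, in which projective
  points are compared.
\<close>

definition den :: "point \<Rightarrow> int" where
  "den s = theta_part (fst s)"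

lemma den_scale [simp]: "den (scale c s) = c * den s"
  by (cases "fst s") (simp add: den_def scale_def of_int_quadint)

lemma den_cong: "scong M s t \<Longrightarrow> M dvd den s - den t"
  by (simp add: den_def scong_iff)

text \<open>
  Equality modulo \<open>M\<close> of the affine points \<open>s / den s\<close> and \<open>t / den t\<close>, with denominators cleared. It
  is an equivalence relation only on points whose denominators are prime to \<open>M\<close>.
\<close>

definition proj_cong :: "int \<Rightarrow> point \<Rightarrow> point \<Rightarrow> bool" where
  "proj_cong M s t \<longleftrightarrow> scong M (scale (den t) s) (scale (den s) t)"

lemma proj_cong_refl: "proj_cong M s s"
  by (simp add: proj_cong_def)

lemma proj_cong_sym: "proj_cong M s t \<Longrightarrow> proj_cong M t s"
  by (simp add: proj_cong_def scong_sym)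

lemma proj_cong_trans:
  assumes "proj_cong M s t" "proj_cong M t u" "coprime (den t) M"
  shows "proj_cong M s u"
proof -
  have "scong M (scale (den u * den t) s) (scale (den u * den s) t)"
    using scong_scale[OF assms(1)[unfolded proj_cong_def], of "den u"] by simp
  moreover have "scong M (scale (den s * den u) t) (scale (den s * den t) u)"
    using scong_scale[OF assms(2)[unfolded proj_cong_def], of "den s"] by simp
  ultimately have "scong M (scale (den t) (scale (den u) s)) (scale (den t) (scale (den s) u))"
    using scong_trans by (fastforce simp: mult_ac)
  then show ?thesis
    using assms(3) scong_cancel by (auto simp: proj_cong_def simp del: scale_scale)
qed

text \<open>
  By homogeneity, \<open>step\<close> descends to projective classes as long as the denominator of \<open>t\<close>
  can be cancelled.
\<close>

lemma proj_cong_step: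
  assumes "proj_cong M s t" "coprime (den t) M"
  shows "proj_cong M (step s) (step t)"
proof -
  let ?c = "den t ^ 7" and ?d = "den s ^ 7" and ?S = "step s" and ?T = "step t"
  have st: "scong M (scale ?c ?S) (scale ?d ?T)"
    using scong_step assms(1) by (fastforce simp: proj_cong_def step_scale)
  have "scong M (scale (den ?T * ?c) ?S) (scale (den ?T * ?d) ?T)"
    using scong_scale[OF st, of "den ?T"] by simp
  moreover have "scong M (scale (den ?T * ?d) ?T) (scale (?c * den ?S) ?T)"
    using den_cong[OF st] by (intro scong_scale_cong) (simp add: mult.commute dvd_diff_commute)
  ultimately have "scong M (scale ?c (scale (den ?T) ?S)) (scale ?c (scale (den ?S) ?T))"
    using scong_trans by (fastforce simp: mult_ac)
  then show ?thesis
    using assms(2) scong_cancel[of M ?c] by (auto simp: proj_cong_def simp del: scale_scale)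
qed

lemma proj_eq_if_all_powers:
  assumes "\<And>k. proj_cong (2 ^ k) s t"
  shows "scale (den t) s = scale (den s) t"
proof -
  have eq: "a = b" if "\<And>k. 2 ^ k dvd a - b" for a b :: int
  proof (rule ccontr)
    assume "a \<noteq> b"
    then have "\<bar>2 ^ nat \<bar>a - b\<bar>\<bar> \<le> \<bar>a - b\<bar>"
      by (intro dvd_imp_le_int that) simp
    moreover have "int (nat \<bar>a - b\<bar>) < int (2 ^ nat \<bar>a - b\<bar>)"
      by (simp only: of_nat_less_iff less_exp)
    ultimately show False by simp
  qed
  let ?u = "scale (den t) s" and ?v = "scale (den s) t"
  have "rat_part (fst ?u) = rat_part (fst ?v)" "theta_part (fst ?u) = theta_part (fst ?v)"
    "rat_part (snd ?u) = rat_part (snd ?v)" "theta_part (snd ?u) = theta_part (snd ?v)"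
    using assms by (intro eq; simp only: proj_cong_def scong_iff)+
  then show ?thesis by (simp only: prod_eq_iff quadint.expand)
qed

section \<open>The orbit modulo powers of 2\<close>

definition orbit :: "nat \<Rightarrow> point" where
  "orbit n = (step ^^ n) (pt 33 (-1) 3 (-33))"

lemma orbit_Suc: "orbit (Suc n) = step (orbit n)"
  by (simp add: orbit_def)

lemma step_mod2:
  "scong 2 (step (pt 1 1 1 1)) (pt 0 1 1 0)" "scong 2 (step (pt 0 1 1 0)) (pt 1 1 1 1)"
  unfolding scong_iff by code_simp+

lemma orbit_mod2: "scong 2 (orbit n) (pt 1 1 1 1) \<or> scong 2 (orbit n) (pt 0 1 1 0)"
proof (induction n)
  case 0
  show ?case by (simp add: orbit_def pt_def scong_iff)
next
  case (Suc n)
  then show ?case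
    unfolding orbit_Suc using scong_step scong_trans step_mod2 by blast
qed

lemma odd_orbit: "odd (den (orbit n))" "odd (rat_part (snd (orbit n)))"
  using orbit_mod2[of n] by (auto simp: den_def scong_iff pt_def)

lemma coprime_den_orbit: "coprime (den (orbit n)) (2 ^ k)"
  using odd_orbit by simp

text \<open>
  Points congruent to a given point modulo \<open>2^k\<close> are told apart modulo \<open>2^(k+1)\<close> by the next binary
  digit of each of the three affine coordinates, which leaves \<open>2^3 = 8\<close> possibilities.
\<close>

lemma orbit_proj_cong_split:
  fixes f :: "nat \<Rightarrow> nat"
  assumes E: "\<And>j. proj_cong (2 ^ k) (orbit (f 0)) (orbit (f j))"
  shows "\<exists>a b. a < b \<and> b \<le> 8 \<and> proj_cong (2 ^ Suc k) (orbit (f a)) (orbit (f b))"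
proof -
  let ?u = "\<lambda>j. orbit (f j)" and ?s = "orbit (f 0)"
  define comps :: "(point \<Rightarrow> int) set" where
    "comps = {\<lambda>s. rat_part (fst s), \<lambda>s. rat_part (snd s), \<lambda>s. theta_part (snd s)}"
  define digit where
    "digit c j = (den ?s * c (?u j) - den (?u j) * c ?s) div 2 ^ k" for c :: "point \<Rightarrow> int" and j
  have c_scale: "c (scale z s) = z * c s" if "c \<in> comps" for c z s
    using that by (cases "fst s"; cases "snd s") (auto simp: comps_def scale_def of_int_quadint)
  have digit: "den ?s * c (?u j) = den (?u j) * c ?s + 2 ^ k * digit c j" if c: "c \<in> comps" for c j
  proof -
    have "2 ^ k dvd c (scale (den (?u j)) ?s) - c (scale (den ?s) (?u j))"
      using E[of j] c unfolding proj_cong_def scong_iff comps_def by auto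
    then have "2 ^ k dvd den ?s * c (?u j) - den (?u j) * c ?s"
      by (simp add: c_scale c dvd_diff_commute)
    then show ?thesis by (simp add: digit_def)
  qed
  define bits where
    "bits j = (even (digit (\<lambda>s. rat_part (fst s)) j), even (digit (\<lambda>s. rat_part (snd s)) j),
       even (digit (\<lambda>s. theta_part (snd s)) j))" for j
  have "card (bits ` {..8}) \<le> card (UNIV :: (bool \<times> bool \<times> bool) set)"
    by (intro card_mono) simp_all
  also have "\<dots> = 8"
    by (simp flip: UNIV_Times_UNIV add: card_cartesian_product)
  finally have "\<not> inj_on bits {..8}"
    by (intro pigeonhole) simp
  then obtain a b where ab: "a < b" "b \<le> 8" "bits a = bits b"
    unfolding inj_on_def by (metis atMost_iff nat_neq_iff)
  have "2 ^ Suc k dvd den (?u b) * c (?u a) - den (?u a) * c (?u b)" if c: "c \<in> comps" for c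
  proof -
    have "even (digit c a) = even (digit c b)" using ab(3) c by (auto simp: bits_def comps_def)
    then have "even (digit c a * den (?u b) - digit c b * den (?u a))"
      using odd_orbit(1) by simp
    moreover have "den ?s * (den (?u b) * c (?u a) - den (?u a) * c (?u b)) =
        den (?u b) * (den ?s * c (?u a)) - den (?u a) * (den ?s * c (?u b))"
      by (simp add: algebra_simps)
    then have "den ?s * (den (?u b) * c (?u a) - den (?u a) * c (?u b)) =
        2 ^ k * (digit c a * den (?u b) - digit c b * den (?u a))"
      unfolding digit[OF c] by (simp add: algebra_simps)
    ultimately have "2 ^ Suc k dvd den ?s * (den (?u b) * c (?u a) - den (?u a) * c (?u b))"
      by (metis mult.commute mult_dvd_mono dvd_refl power_Suc)
    moreover have "coprime (2 ^ Suc k) (den ?s)"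
      using odd_orbit(1) by simp
    ultimately show ?thesis using coprime_dvd_mult_right_iff by blast
  qed
  then have dvd: "2 ^ Suc k dvd c (scale (den (?u b)) (?u a)) - c (scale (den (?u a)) (?u b))"
    if "c \<in> comps" for c
    using that by (simp only: c_scale)
  have "theta_part (fst (scale (den (?u b)) (?u a))) = theta_part (fst (scale (den (?u a)) (?u b)))"
    using den_scale[of "den (?u b)" "?u a"] den_scale[of "den (?u a)" "?u b"] by (simp add: den_def)
  then have "proj_cong (2 ^ Suc k) (?u a) (?u b)"
    unfolding proj_cong_def scong_iff
    using dvd[of "\<lambda>s. rat_part (fst s)"] dvd[of "\<lambda>s. rat_part (snd s)"] dvd[of "\<lambda>s. theta_part (snd s)"]
    by (simp add: comps_def)
  then show ?thesis using ab by blast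
qed

lemma proj_cong_orbit_shift:
  "proj_cong (2 ^ k) (orbit i) (orbit j) \<Longrightarrow> proj_cong (2 ^ k) (orbit (d + i)) (orbit (d + j))"
  by (induction d) (simp_all add: orbit_Suc proj_cong_step[OF _ coprime_den_orbit])

section \<open>The orbit modulo 7\<close>

fun red7 :: "point \<Rightarrow> point" where
  "red7 (Q a b, Q c d) = (Q (a mod 7) (b mod 7), Q (c mod 7) (d mod 7))"

lemma scong_red7: "scong 7 s (red7 s)"
  by (cases s rule: red7.cases) (simp add: scong_iff)

fun iterates7 :: "nat \<Rightarrow> point \<Rightarrow> point list" where
  "iterates7 0 s = [s]"
| "iterates7 (Suc n) s = s # iterates7 n (red7 (step s))"

text \<open>
  The starting point has denominator 1, so this says that \<open>u\<close> is not a multiple of it modulo 7. The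
  zero vector counts as a multiple, which covers the points whose denominator vanishes modulo 7.
\<close>

definition differs_from_start7 :: "point \<Rightarrow> bool" where
  "differs_from_start7 u \<longleftrightarrow> \<not> scong 7 (scale (den u) (pt 33 (-1) 3 (-33))) u"

lemma differs_from_start7_code: "differs_from_start7 u \<longleftrightarrow> (case u of (Q a b, Q c d) \<Rightarrow>
   \<not> (7 dvd b * 32 - a \<and> 7 dvd b * 3 - c \<and> 7 dvd b * (-33) - d))"
  by (cases u rule: red7.cases)
    (simp add: differs_from_start7_def scong_iff scale_def pt_def den_def of_int_quadint)

text \<open>
  The vectors themselves, and not only the projective points, return after 33 steps: modulo 7 a
  scalar factor \<open>c\<close> is passed on by \<open>step\<close> as \<open>c^7 = c\<close>.
\<close>

lemma cycle7:
  "red7 (last (iterates7 33 (pt 33 (-1) 3 (-33)))) = red7 (pt 33 (-1) 3 (-33))"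
  "list_all differs_from_start7 (tl (butlast (iterates7 33 (pt 33 (-1) 3 (-33)))))"
  unfolding differs_from_start7_code[abs_def] by code_simp+

lemma orbit_33: "scong 7 (orbit (33 + n)) (orbit n)"
  and differs_from_start7_orbit: "0 < i \<Longrightarrow> i < 33 \<Longrightarrow> \<not> scong 7 (scale (den (orbit i)) (orbit 0)) (orbit i)"
proof -
  let ?s = "pt 33 (-1) 3 (-33)" and ?g = "\<lambda>s. red7 (step s)"
  have len: "length (iterates7 N s) = Suc N" for N s
    by (induction N arbitrary: s) simp_all
  have nth: "iterates7 N s ! i = (?g ^^ i) s" if "i \<le> N" for N i s
    using that
  proof (induction N arbitrary: s i)
    case (Suc N)
    then show ?case by (cases i) (simp_all add: funpow_Suc_right del: funpow.simps)
  qed simp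
  have orbit: "scong 7 (orbit i) ((?g ^^ i) ?s)" for i
  proof (induction i)
    case (Suc i)
    then show ?case
      unfolding orbit_Suc using scong_trans[OF scong_step scong_red7] by simp
  qed (simp add: orbit_def)
  have "last (iterates7 33 ?s) = iterates7 33 ?s ! 33"
    by (subst last_conv_nth) (simp_all add: len flip: length_greater_0_conv)
  then have "red7 ((?g ^^ 33) ?s) = red7 ?s"
    using cycle7(1) nth[of 33 33 ?s] by simp
  moreover have "orbit 0 = ?s" by (simp add: orbit_def)
  ultimately have period: "scong 7 (orbit 33) (orbit 0)"
    using scong_trans[OF orbit[of 33] scong_red7] scong_sym[OF scong_red7[of ?s]]
    by (metis scong_trans)
  show "scong 7 (orbit (33 + n)) (orbit n)"
  proof (induction n)
    case 0
    show ?case using period by simp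
  next
    case (Suc n)
    show ?case using scong_step[OF Suc] by (simp only: add_Suc_right orbit_Suc)
  qed
  assume i: "0 < i" "i < 33"
  have "tl (butlast (iterates7 33 ?s)) ! (i - 1) \<in> set (tl (butlast (iterates7 33 ?s)))"
    using i by (intro nth_mem) (simp add: len)
  moreover have "tl (butlast (iterates7 33 ?s)) ! (i - 1) = (?g ^^ i) ?s"
    using i by (simp add: nth_tl nth_butlast len nth)
  ultimately have "differs_from_start7 ((?g ^^ i) ?s)"
    using cycle7(2) by (simp add: list_all_iff)
  then have "\<not> scong 7 (scale (den ((?g ^^ i) ?s)) (orbit 0)) ((?g ^^ i) ?s)"
    by (simp add: differs_from_start7_def orbit_def)
  moreover have "scong 7 (scale (den u) (orbit 0)) u"
    if "scong 7 (scale (den (orbit i)) (orbit 0)) (orbit i)" and u: "scong 7 (orbit i) u" for u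
    using that(1) u scong_scale_cong[OF den_cong[OF scong_sym[OF u]]] scong_trans by blast
  ultimately show "\<not> scong 7 (scale (den (orbit i)) (orbit 0)) (orbit i)"
    using orbit[of i] by blast
qed

lemma orbit_mod_33: "scong 7 (orbit n) (orbit (n mod 33))"
proof -
  have "scong 7 (orbit (33 * q + i)) (orbit i)" for q i
  proof (induction q)
    case (Suc q)
    show ?case using scong_trans[OF orbit_33[of "33 * q + i"] Suc] by (simp add: add_ac)
  qed simp
  from this[of "n div 33" "n mod 33"] show ?thesis by simp
qed

text \<open>
  Shifting the index \<open>i\<close> to the multiple \<open>33 i\<close> of the period reduces the comparison of two arbitrary
  points to a comparison with the starting point. In fact 33 divides \<open>n\<close>; the prime factor 11 is the
  one that exceeds the number 8 of classes.
\<close>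

lemma orbit_separated_mod_11:
  assumes "\<And>k. proj_cong (2 ^ k) (orbit i) (orbit (i + n))"
  shows "11 dvd n"
proof -
  define j where "j = 33 * i + n"
  define m where "m = n mod 33"
  have "proj_cong (2 ^ k) (orbit (33 * i)) (orbit j)" for k
    using proj_cong_orbit_shift[OF assms, of k "32 * i"] by (simp add: j_def add_ac)
  then have eq: "scale (den (orbit j)) (orbit (33 * i)) = scale (den (orbit (33 * i))) (orbit j)"
    by (rule proj_eq_if_all_powers)
  have i0: "scong 7 (orbit (33 * i)) (orbit 0)"
    using orbit_mod_33[of "33 * i"] by simp
  have jm: "scong 7 (orbit j) (orbit m)"
    using orbit_mod_33[of j] by (simp add: j_def m_def)
  have "scong 7 (scale (den (orbit m)) (orbit 0)) (scale (den (orbit j)) (orbit 0))"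
    by (intro scong_scale_cong den_cong scong_sym[OF jm])
  also have "scong 7 \<dots> (scale (den (orbit j)) (orbit (33 * i)))"
    by (intro scong_scale scong_sym[OF i0])
  also have "\<dots> = scale (den (orbit (33 * i))) (orbit j)" by (rule eq)
  also have "scong 7 \<dots> (scale (den (orbit (33 * i))) (orbit m))"
    by (intro scong_scale jm)
  also have "scong 7 \<dots> (scale (den (orbit 0)) (orbit m))"
    by (intro scong_scale_cong den_cong i0)
  also have "scale (den (orbit 0)) (orbit m) = orbit m"
    by (simp add: orbit_def pt_def den_def scale_def)
  finally have "m = 0" using differs_from_start7_orbit[of m] by (auto simp: m_def)
  then show ?thesis by (auto simp: m_def)
qed

section \<open>Infinitely many solutions\<close>

text \<open>
  Think of \<open>E k i j\<close> as congruence at level \<open>k\<close> of the points number \<open>i\<close> and \<open>j\<close> of an orbit. Take the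
  least positive \<open>n\<close> for which some point \<open>i\<close> returns to itself at every level after \<open>n\<close> steps, write
  \<open>n = r M\<close>, and take the least level \<open>l\<close> separating \<open>i\<close> from \<open>i + M\<close>. One level below, all points
  \<open>i + j M\<close> are congruent, so two of the first \<open>m + 1\<close> of them are congruent at level \<open>l\<close>; say that their
  distance is \<open>e M\<close> with \<open>0 < e \<le> m\<close>. From then on, level \<open>l\<close> has the periods \<open>e M\<close> and \<open>r M\<close>, hence also
  \<open>M\<close>, as \<open>e\<close> and \<open>r\<close> are coprime; and since \<open>i\<close> itself is periodic, this reaches back to \<open>i\<close>.
\<close>

lemma refinement_separates:
  fixes E :: "nat \<Rightarrow> nat \<Rightarrow> nat \<Rightarrow> bool" and m r :: nat
  assumes sym: "\<And>k i j. E k i j \<Longrightarrow> E k j i"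
    and trans: "\<And>k h i j. E k h i \<Longrightarrow> E k i j \<Longrightarrow> E k h j"
    and refl: "\<And>k i. E k i i"
    and base: "\<And>i j. E 0 i j"
    and shift: "\<And>k i j. E k i j \<Longrightarrow> E k (Suc i) (Suc j)"
    and split: "\<And>k f. (\<And>j. E k (f 0) (f j)) \<Longrightarrow> \<exists>a b. a < b \<and> b \<le> m \<and> E (Suc k) (f a) (f b)"
    and coprime: "\<And>e. 0 < e \<Longrightarrow> e \<le> m \<Longrightarrow> coprime e r"
    and separate: "\<And>i n. (\<And>k. E k i (i + n)) \<Longrightarrow> r dvd n"
    and r: "r > 1"
    and ij: "\<And>k. E k i j"
  shows "i = j"
proof (rule ccontr)
  assume "i \<noteq> j"
  define T where "T n \<longleftrightarrow> n > 0 \<and> (\<exists>i. \<forall>k. E k i (i + n))" for n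
  have "T (max i j - min i j)"
    unfolding T_def
  proof (intro conjI exI allI)
    show "0 < max i j - min i j" using \<open>i \<noteq> j\<close> by simp
    show "E k (min i j) (min i j + (max i j - min i j))" for k
      using ij[of k] sym by (cases "i \<le> j") auto
  qed
  define n where "n = (LEAST n. T n)"
  have "T n" unfolding n_def by (rule LeastI) fact
  then obtain i where n0: "n > 0" and i: "\<And>k. E k i (i + n)" by (auto simp: T_def)
  obtain M where M: "n = r * M" using separate[OF i] by (elim dvdE)
  then have "0 < M" "M < n" using n0 r by auto
  then have "\<not> T M" unfolding n_def by (intro not_less_Least) simp
  then obtain k0 where k0: "\<not> E k0 i (i + M)" using \<open>0 < M\<close> by (auto simp: T_def)
  define l where "l = (LEAST k. \<not> E k i (i + M))"
  have l: "\<not> E l i (i + M)" unfolding l_def by (rule LeastI) fact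
  then obtain k where k: "l = Suc k" using base by (cases l) auto
  have "E k i (i + M)" using not_less_Least[of k "\<lambda>k. \<not> E k i (i + M)"] by (simp add: k flip: l_def)
  have shifts: "E k (i + d) (j + d)" if "E k i j" for k i j d
    using that shift by (induction d) auto
  have "E k i (i + j * M)" for j
  proof (induction j)
    case (Suc j)
    show ?case
      using trans[OF Suc shifts[OF \<open>E k i (i + M)\<close>, of "j * M"]] by (simp add: add_ac)
  qed (simp add: refl)
  then obtain a b where ab: "a < b" "b \<le> m" "E l (i + a * M) (i + b * M)"
    using split[of k "\<lambda>j. i + j * M"] by (auto simp: k)
  define period where "period d \<longleftrightarrow> (\<exists>h. \<forall>i\<ge>h. E l i (i + d))" for d
  have periodI: "period d" if "E l h (h + d)" for h d
    unfolding period_def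
  proof (intro exI allI impI)
    fix i assume "h \<le> i"
    then show "E l i (i + d)" using shifts[OF that, of "i - h"] by (simp add: add_ac)
  qed
  have period_mult: "period (c * d)" if d: "period d" for c d
  proof -
    obtain h where h: "\<And>i. i \<ge> h \<Longrightarrow> E l i (i + d)" using d by (auto simp: period_def)
    have "E l h (h + c * d)"
    proof (induction c)
      case (Suc c)
      show ?case using trans[OF Suc h[of "h + c * d"]] by (simp add: add_ac)
    qed (simp add: refl)
    then show ?thesis by (rule periodI)
  qed
  have "period (n * 1)" using i by (intro periodI) simp
  have "period ((b - a) * M)"
  proof (rule periodI)
    have "i + a * M + (b - a) * M = i + b * M" using ab(1) by (simp add: diff_mult_distrib)
    then show "E l (i + a * M) (i + a * M + (b - a) * M)" using ab(3) by (simp only:)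
  qed
  obtain x y where xy: "(b - a) * x = r * y + 1"
    using bezout_nat[of "b - a" r] coprime[of "b - a"] ab by auto
  have "period (x * ((b - a) * M))" by (rule period_mult) fact
  also have "x * ((b - a) * M) = (b - a) * x * M" by simp
  also have "\<dots> = y * n + M" unfolding xy M by (simp add: algebra_simps)
  finally obtain h1 where h1: "\<And>i. i \<ge> h1 \<Longrightarrow> E l i (i + (y * n + M))" by (auto simp: period_def)
  have "period (y * n)" using period_mult[OF \<open>period (n * 1)\<close>, of y] by simp
  then obtain h2 where h2: "\<And>i. i \<ge> h2 \<Longrightarrow> E l i (i + y * n)" by (auto simp: period_def)
  \<comment> \<open>a multiple of \<open>n\<close> large enough for both eventual periods to apply\<close>
  define q where "q = (h1 + h2) * n"
  have q: "q \<ge> h1 + h2" using n0 by (simp add: q_def)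
  have "E l (i + q) (i + q + (y * n + M))" "E l (i + q + M) (i + q + M + y * n)"
    using h1 h2 q by simp_all
  then have "E l (i + q) (i + q + M)"
    using trans sym by (metis add.assoc add.commute)
  moreover have iq: "E l i (i + q)"
  proof -
    have "E l i (i + c * n)" for c
    proof (induction c)
      case (Suc c)
      show ?case using trans[OF Suc shifts[OF i, of l "c * n"]] by (simp add: add_ac)
    qed (simp add: refl)
    then show ?thesis by (simp add: q_def)
  qed
  ultimately show False
    using l trans sym shifts[OF iq, of M] by (metis add.assoc add.commute)
qed

lemma orbit_proj_inj:
  assumes "scale (den (orbit j)) (orbit i) = scale (den (orbit i)) (orbit j)"
  shows "i = j"
proof (rule refinement_separates[where E = "\<lambda>k i j. proj_cong (2 ^ k) (orbit i) (orbit j)" and m = 8 and r = 11])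
  fix k h i j
  show "proj_cong (2 ^ k) (orbit i) (orbit j) \<Longrightarrow> proj_cong (2 ^ k) (orbit j) (orbit i)"
    by (rule proj_cong_sym)
  show "proj_cong (2 ^ k) (orbit h) (orbit i) \<Longrightarrow> proj_cong (2 ^ k) (orbit i) (orbit j)
      \<Longrightarrow> proj_cong (2 ^ k) (orbit h) (orbit j)"
    by (rule proj_cong_trans[OF _ _ coprime_den_orbit])
  show "proj_cong (2 ^ k) (orbit i) (orbit j) \<Longrightarrow> proj_cong (2 ^ k) (orbit (Suc i)) (orbit (Suc j))"
    using proj_cong_orbit_shift[of k i j 1] by simp
next
  show "proj_cong (2 ^ k) (orbit i) (orbit i)" for k i
    by (rule proj_cong_refl)
  show "proj_cong (2 ^ 0) (orbit i) (orbit j)" for i j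
    by (simp add: proj_cong_def scong_iff)
  show "proj_cong (2 ^ k) (orbit i) (orbit j)" for k
    by (simp add: proj_cong_def assms)
  show "\<exists>a b. a < b \<and> b \<le> 8 \<and> proj_cong (2 ^ Suc k) (orbit (f a)) (orbit (f b))"
    if "\<And>j. proj_cong (2 ^ k) (orbit (f 0)) (orbit (f j))" for k and f :: "nat \<Rightarrow> nat"
    using that by (rule orbit_proj_cong_split)
  show "11 dvd n" if "\<And>k. proj_cong (2 ^ k) (orbit i) (orbit (i + n))" for i n
    using that by (rule orbit_separated_mod_11)
  show "(1 :: nat) < 11" by simp
  show "coprime e 11" if "0 < e" "e \<le> 8" for e :: nat
  proof -
    have "e \<in> {1, 2, 3, 4, 5, 6, 7, 8}" using that by auto
    then show ?thesis by (auto simp: coprime_iff_gcd_eq_1 gcd_non_0_nat)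
  qed
qed

definition coords :: "point \<Rightarrow> int \<times> int \<times> int \<times> int" where
  "coords s = (rat_part (fst s) + theta_part (fst s), - theta_part (fst s), rat_part (snd s), theta_part (snd s))"

lemma coords_pt [simp]: "coords (pt x1 x2 x3 x4) = (x1, x2, x3, x4)"
  by (simp add: coords_def pt_def)

lemma orbit_on_sextic: "orbit n = pt x1 x2 x3 x4 \<Longrightarrow> sextic x1 x2 x3 x4 = 0"
proof (induction n arbitrary: x1 x2 x3 x4)
  case 0
  then have "coords (orbit 0) = (x1, x2, x3, x4)" by simp
  then have "x1 = 33" "x2 = - 1" "x3 = 3" "x4 = - 33" by (simp_all add: orbit_def)
  then show ?case by (simp add: sextic_def)
next
  case (Suc n)
  obtain y1 y2 y3 y4 where y: "orbit n = pt y1 y2 y3 y4" by (rule pt_cases)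
  show ?case using sextic_step[OF Suc.IH[OF y]] Suc.prems by (simp add: orbit_Suc y)
qed

lemma not_proportional_orbit:
  assumes "i \<noteq> j"
  shows "\<not> proportional (coords (orbit i)) (coords (orbit j))"
proof
  obtain x1 x2 x3 x4 where x: "orbit i = pt x1 x2 x3 x4" by (rule pt_cases)
  obtain y1 y2 y3 y4 where y: "orbit j = pt y1 y2 y3 y4" by (rule pt_cases)
  assume "proportional (coords (orbit i)) (coords (orbit j))"
  then obtain c :: rat where c: "of_int y1 = c * of_int x1" "of_int y2 = c * of_int x2"
      "of_int y3 = c * of_int x3" "of_int y4 = c * of_int x4"
    by (auto simp: x y proportional_def)
  have "of_int (y2 * x1) = (of_int (x2 * y1) :: rat)" "of_int (y2 * x3) = (of_int (x2 * y3) :: rat)"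
    "of_int (y2 * x4) = (of_int (x2 * y4) :: rat)"
    by (simp_all add: c)
  then have "y2 * x1 = x2 * y1" "y2 * x3 = x2 * y3" "y2 * x4 = x2 * y4"
    by (simp_all only: of_int_eq_iff)
  then have "scale (den (orbit j)) (orbit i) = scale (den (orbit i)) (orbit j)"
    by (simp add: x y pt_def scale_def den_def of_int_quadint algebra_simps)
  then show False using orbit_proj_inj assms by blast
qed

theorem mainTheorem5:
  "\<exists>S :: (int \<times> int \<times> int \<times> int) set.
     infinite S \<and>
     (\<forall>(x1, x2, x3, x4) \<in> S.
        sextic x1 x2 x3 x4 = 0 \<and> (x1, x2) \<noteq> (0, 0) \<and> (x3, x4) \<noteq> (0, 0)) \<and>
     (\<forall>x \<in> S. \<forall>y \<in> S. x \<noteq> y \<longrightarrow> \<not> proportional x y)"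
proof (intro exI conjI)
  let ?S = "range (\<lambda>n. coords (orbit n))"
  have "proportional s s" for s
    by (cases s) (auto simp: proportional_def intro!: exI[of _ 1])
  then have "inj (\<lambda>n. coords (orbit n))"
    using not_proportional_orbit by (intro injI) metis
  then show "infinite ?S" using finite_imageD infinite_UNIV_nat by blast
  show "\<forall>x\<in>?S. \<forall>y\<in>?S. x \<noteq> y \<longrightarrow> \<not> proportional x y"
  proof (intro ballI impI)
    fix x y assume "x \<in> ?S" "y \<in> ?S" "x \<noteq> y"
    then obtain i j where "x = coords (orbit i)" "y = coords (orbit j)" by auto
    with \<open>x \<noteq> y\<close> show "\<not> proportional x y" using not_proportional_orbit[of i j] by auto
  qed
  show "\<forall>(x1, x2, x3, x4) \<in> ?S. sextic x1 x2 x3 x4 = 0 \<and> (x1, x2) \<noteq> (0, 0) \<and> (x3, x4) \<noteq> (0, 0)"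
  proof clarify
    fix x1 x2 x3 x4 n
    assume x: "(x1, x2, x3, x4) = coords (orbit n)"
    then have "orbit n = pt x1 x2 x3 x4"
      by (metis coords_pt pt_cases prod.inject)
    then show "sextic x1 x2 x3 x4 = 0 \<and> (x1, x2) \<noteq> (0, 0) \<and> (x3, x4) \<noteq> (0, 0)"
      using orbit_on_sextic odd_orbit[of n] by (auto simp: pt_def den_def)
  qed
qed

end
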